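(* Assume (G5): for every object $U$ of $\mathbf C$, every arrow in $\Sigma(U)$ is monic. Then for every cover $f$, the degree of any Galois closure of $f$ divides $(\deg f)!$.
   Context: Let $\mathbf C$ be a category and $\mathbf D$ a full subcategory of $\mathbf C$. For arrows $f,g$ of $\mathbf C$ with ${\rm cod}\,f={\rm cod}\,g$, ${\rm Hom}(g,f)$ denotes the collection of all arrows $h$ of $\mathbf C$ with $g=f\circ h$. Standing assumptions: (G1) every diagram $B\to A\leftarrow C$ in $\mathbf D$ has a pullback in $\mathbf C$. (G2) (I) pushouts exist in $\mathbf D$; (II) every arrow of $\mathbf D$ is epic; (III) every monic arrow of $\mathbf D$ is an isomorphism whose inverse is an arrow of $\mathbf D$. (G3) for every object $U$ of $\mathbf C$ there is a set $\Sigma(U)$ of arrows $i$ of $\mathbf C$ with ${\rm dom}\,i$ in $\mathbf D$ and ${\rm cod}\,i=U$ such that for every arrow $u$ of $\mathbf C$ with ${\rm dom}\,u$ in $\mathbf D$ and ${\rm cod}\,u=U$ there is exactly one $i\in\Sigma(U)$ with ${\rm Hom}(u,i)\neq\emptyset$. (G4) there is a function $\deg$ from the collection of arrows of $\mathbf C$ whose codomain lies in $\mathbf D$ to the positive integers such that (I) $\deg(g\circ f)=\deg g\cdot\deg f$ whenever $f,g,g\circ f$ all lie in this collection; (II) $\deg f=\sum_{i\in\Sigma({\rm dom}\,f)}\deg(f\circ i)$ for every such $f$; (III) if $B\xrightarrow{f}A\xleftarrow{g}C$ is a diagram in $\mathbf D$ with pullback $B\xleftarrow{p}U\xrightarrow{q}C$,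 then $\deg f=\deg q$ and $\deg g=\deg p$. A cover is an arrow of $\mathbf D$. For a cover $f$, ${\rm Aut}(f)$ is the set of isomorphisms in ${\rm Hom}(f,f)$; $f$ is Galois if $|{\rm Aut}(f)|=\deg f$. Write $f\sqsubseteq g$ if ${\rm cod}\,f={\rm cod}\,g$ and ${\rm Hom}(g,f)\neq\emptyset$. A Galois closure of a cover $f$ is a cover $g$ which is Galois with $f\sqsubseteq g$ and such that $g\sqsubseteq h$ for every Galois cover $h$ with $f\sqsubseteq h\sqsubseteq g$. *)

theory Defs
  imports Complex_Main
begin

section \<open>Categories\<close>

text \<open>\<^term>\<open>Comp C g f\<close> is the composite "g after f".\<close>

record ('o, 'a) cat =
  Obj :: "'o set"
  Arr :: "'a set"
  Dom :: "'a \<Rightarrow> 'o"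
  Cod :: "'a \<Rightarrow> 'o"
  Id :: "'o \<Rightarrow> 'a"
  Comp :: "'a \<Rightarrow> 'a \<Rightarrow> 'a"

locale category =
  fixes C :: "('o, 'a) cat"
  assumes Dom_in: "f \<in> Arr C \<Longrightarrow> Dom C f \<in> Obj C"
    and Cod_in: "f \<in> Arr C \<Longrightarrow> Cod C f \<in> Obj C"
    and Id_in: "A \<in> Obj C \<Longrightarrow> Id C A \<in> Arr C"
    and Dom_Id: "A \<in> Obj C \<Longrightarrow> Dom C (Id C A) = A"
    and Cod_Id: "A \<in> Obj C \<Longrightarrow> Cod C (Id C A) = A"
    and Comp_in: "\<lbrakk>f \<in> Arr C; g \<in> Arr C; Cod C f = Dom C g\<rbrakk> \<Longrightarrow> Comp C g f \<in> Arr C"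
    and Dom_Comp: "\<lbrakk>f \<in> Arr C; g \<in> Arr C; Cod C f = Dom C g\<rbrakk> \<Longrightarrow> Dom C (Comp C g f) = Dom C f"
    and Cod_Comp: "\<lbrakk>f \<in> Arr C; g \<in> Arr C; Cod C f = Dom C g\<rbrakk> \<Longrightarrow> Cod C (Comp C g f) = Cod C g"
    and Comp_assoc: "\<lbrakk>f \<in> Arr C; g \<in> Arr C; h \<in> Arr C; Cod C f = Dom C g; Cod C g = Dom C h\<rbrakk>
          \<Longrightarrow> Comp C (Comp C h g) f = Comp C h (Comp C g f)"
    and Comp_Id_right: "f \<in> Arr C \<Longrightarrow> Comp C f (Id C (Dom C f)) = f"
    and Comp_Id_left: "f \<in> Arr C \<Longrightarrow> Comp C (Id C (Cod C f)) f = f"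

text \<open>A full subcategory is determined by its set of objects.\<close>

definition full_subcat :: "('o, 'a) cat \<Rightarrow> 'o set \<Rightarrow> ('o, 'a) cat" where
  "full_subcat C S = C\<lparr>Obj := S, Arr := {f \<in> Arr C. Dom C f \<in> S \<and> Cod C f \<in> S}\<rparr>"

lemma (in category) category_full_subcat: "S \<subseteq> Obj C \<Longrightarrow> category (full_subcat C S)"
  by unfold_locales
    (auto simp: full_subcat_def Dom_in Cod_in Id_in Dom_Id Cod_Id Comp_in Dom_Comp Cod_Comp
        Comp_assoc Comp_Id_right Comp_Id_left)

definition epic :: "('o, 'a) cat \<Rightarrow> 'a \<Rightarrow> bool" where
  "epic C f \<longleftrightarrow> f \<in> Arr C \<and>
     (\<forall>u\<in>Arr C. \<forall>v\<in>Arr C. Dom C u = Cod C f \<longrightarrow> Dom C v = Cod C f \<longrightarrow> Cod C u = Cod C v \<longrightarrow>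
        Comp C u f = Comp C v f \<longrightarrow> u = v)"

definition monic :: "('o, 'a) cat \<Rightarrow> 'a \<Rightarrow> bool" where
  "monic C f \<longleftrightarrow> f \<in> Arr C \<and>
     (\<forall>u\<in>Arr C. \<forall>v\<in>Arr C. Cod C u = Dom C f \<longrightarrow> Cod C v = Dom C f \<longrightarrow> Dom C u = Dom C v \<longrightarrow>
        Comp C f u = Comp C f v \<longrightarrow> u = v)"

definition inverse_arrows :: "('o, 'a) cat \<Rightarrow> 'a \<Rightarrow> 'a \<Rightarrow> bool" where
  "inverse_arrows C f g \<longleftrightarrow> f \<in> Arr C \<and> g \<in> Arr C \<and> Dom C g = Cod C f \<and> Cod C g = Dom C f \<and>
     Comp C g f = Id C (Dom C f) \<and> Comp C f g = Id C (Cod C f)"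

definition iso :: "('o, 'a) cat \<Rightarrow> 'a \<Rightarrow> bool" where
  "iso C f \<longleftrightarrow> (\<exists>g. inverse_arrows C f g)"

text \<open>The cospan \<open>B \<rightarrow> A \<leftarrow> C\<close> given by \<open>f, g\<close> has the pullback
  \<open>B \<leftarrow> U \<rightarrow> C\<close> given by \<open>p, q\<close>.\<close>

definition is_pullback :: "('o, 'a) cat \<Rightarrow> 'a \<Rightarrow> 'a \<Rightarrow> 'a \<Rightarrow> 'a \<Rightarrow> bool" where
  "is_pullback C f g p q \<longleftrightarrow>
     f \<in> Arr C \<and> g \<in> Arr C \<and> p \<in> Arr C \<and> q \<in> Arr C \<and> Cod C f = Cod C g \<and>
     Dom C p = Dom C q \<and> Cod C p = Dom C f \<and> Cod C q = Dom C g \<and> Comp C f p = Comp C g q \<and>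
     (\<forall>u\<in>Arr C. \<forall>v\<in>Arr C.
        Dom C u = Dom C v \<longrightarrow> Cod C u = Dom C f \<longrightarrow> Cod C v = Dom C g \<longrightarrow> Comp C f u = Comp C g v \<longrightarrow>
        (\<exists>!w. w \<in> Arr C \<and> Dom C w = Dom C u \<and> Cod C w = Dom C p \<and>
              Comp C p w = u \<and> Comp C q w = v))"

definition is_pushout :: "('o, 'a) cat \<Rightarrow> 'a \<Rightarrow> 'a \<Rightarrow> 'a \<Rightarrow> 'a \<Rightarrow> bool" where
  "is_pushout C f g p q \<longleftrightarrow>
     f \<in> Arr C \<and> g \<in> Arr C \<and> p \<in> Arr C \<and> q \<in> Arr C \<and> Dom C f = Dom C g \<and>
     Cod C p = Cod C q \<and> Dom C p = Cod C f \<and> Dom C q = Cod C g \<and> Comp C p f = Comp C q g \<and>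
     (\<forall>u\<in>Arr C. \<forall>v\<in>Arr C.
        Cod C u = Cod C v \<longrightarrow> Dom C u = Cod C f \<longrightarrow> Dom C v = Cod C g \<longrightarrow> Comp C u f = Comp C v g \<longrightarrow>
        (\<exists>!w. w \<in> Arr C \<and> Dom C w = Cod C p \<and> Cod C w = Cod C u \<and>
              Comp C w p = u \<and> Comp C w q = v))"

text \<open>\<open>Hom C g f\<close> is not a hom-set between objects: for arrows \<open>f, g\<close> with common codomain it
  is the set of arrows \<open>h\<close> with \<open>g = f \<circ> h\<close>.\<close>

definition Hom :: "('o, 'a) cat \<Rightarrow> 'a \<Rightarrow> 'a \<Rightarrow> 'a set" where
  "Hom C g f = {h \<in> Arr C. Cod C h = Dom C f \<and> g = Comp C f h}"

section \<open>Abstract covering theory\<close>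

text \<open>\<open>S\<close> is the set of objects of the full subcategory \<open>\<D>\<close>. "Epic" and "monic" for arrows of
  \<open>\<D>\<close> are meant in the ambient category, while pushouts are taken in \<open>\<D>\<close>. The degree is only
  constrained on arrows with codomain in \<open>S\<close>. A sum of positive integers having a finite value
  forces the index set to be finite; since \<^const>\<open>sum\<close> is 0 on infinite sets, this is spelled
  out in \<open>G4_II\<close>.\<close>

locale covering_setting = category C
  for C :: "('o, 'a) cat" +
  fixes S :: "'o set"
    and \<Sigma> :: "'o \<Rightarrow> 'a set"
    and deg :: "'a \<Rightarrow> nat"
  assumes S_subset: "S \<subseteq> Obj C"
    and G1: "\<lbrakk>f \<in> Arr (full_subcat C S); g \<in> Arr (full_subcat C S); Cod C f = Cod C g\<rbrakk>
          \<Longrightarrow> \<exists>p q. is_pullback C f g p q"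
    and G2_I: "\<lbrakk>f \<in> Arr (full_subcat C S); g \<in> Arr (full_subcat C S); Dom C f = Dom C g\<rbrakk>
          \<Longrightarrow> \<exists>p q. is_pushout (full_subcat C S) f g p q"
    and G2_II: "f \<in> Arr (full_subcat C S) \<Longrightarrow> epic C f"
    and G2_III: "\<lbrakk>f \<in> Arr (full_subcat C S); monic C f\<rbrakk>
          \<Longrightarrow> \<exists>g \<in> Arr (full_subcat C S). inverse_arrows C f g"
    and G3_arrows: "\<lbrakk>U \<in> Obj C; i \<in> \<Sigma> U\<rbrakk> \<Longrightarrow> i \<in> Arr C \<and> Dom C i \<in> S \<and> Cod C i = U"
    and G3_unique: "\<lbrakk>U \<in> Obj C; u \<in> Arr C; Dom C u \<in> S; Cod C u = U\<rbrakk>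
          \<Longrightarrow> \<exists>!i. i \<in> \<Sigma> U \<and> Hom C u i \<noteq> {}"
    and G4_pos: "\<lbrakk>f \<in> Arr C; Cod C f \<in> S\<rbrakk> \<Longrightarrow> deg f > 0"
    and G4_I: "\<lbrakk>f \<in> Arr C; g \<in> Arr C; Cod C f = Dom C g; Cod C f \<in> S; Cod C g \<in> S\<rbrakk>
          \<Longrightarrow> deg (Comp C g f) = deg g * deg f"
    and G4_II: "\<lbrakk>f \<in> Arr C; Cod C f \<in> S\<rbrakk>
          \<Longrightarrow> finite (\<Sigma> (Dom C f)) \<and> deg f = (\<Sum>i\<in>\<Sigma> (Dom C f). deg (Comp C f i))"
    and G4_III: "\<lbrakk>f \<in> Arr (full_subcat C S); g \<in> Arr (full_subcat C S); is_pullback C f g p q\<rbrakk>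
          \<Longrightarrow> deg f = deg q \<and> deg g = deg p"

definition cover :: "('o, 'a) cat \<Rightarrow> 'o set \<Rightarrow> 'a \<Rightarrow> bool" where
  "cover C S f \<longleftrightarrow> f \<in> Arr (full_subcat C S)"

definition Aut :: "('o, 'a) cat \<Rightarrow> 'a \<Rightarrow> 'a set" where
  "Aut C f = {h \<in> Hom C f f. iso C h}"

text \<open>For a cover the degree is positive, so the equation below also forces \<open>Aut C f\<close> to be
  finite.\<close>

definition galois_cover :: "('o, 'a) cat \<Rightarrow> 'o set \<Rightarrow> ('a \<Rightarrow> nat) \<Rightarrow> 'a \<Rightarrow> bool" where
  "galois_cover C S deg f \<longleftrightarrow> cover C S f \<and> card (Aut C f) = deg f"

definition below :: "('o, 'a) cat \<Rightarrow> 'a \<Rightarrow> 'a \<Rightarrow> bool" where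
  "below C f g \<longleftrightarrow> Cod C f = Cod C g \<and> Hom C g f \<noteq> {}"

definition galois_closure ::
    "('o, 'a) cat \<Rightarrow> 'o set \<Rightarrow> ('a \<Rightarrow> nat) \<Rightarrow> 'a \<Rightarrow> 'a \<Rightarrow> bool" where
  "galois_closure C S deg f g \<longleftrightarrow>
     galois_cover C S deg g \<and> below C f g \<and>
     (\<forall>h. galois_cover C S deg h \<longrightarrow> below C f h \<longrightarrow> below C h g \<longrightarrow> below C g h)"

end

theory Submission
  imports Defs "HOL-Algebra.Bij" "HOL-Algebra.Coset" "HOL-Combinatorics.Permutations"
begin

text \<open>Since \<open>g\<close> is Galois, \<open>Aut g\<close> has \<open>deg g\<close> elements, and it acts by precomposition on
  \<open>Hom(g,f)\<close>, which has at most \<open>deg f\<close> elements. If this action is faithful, Lagrange's theorem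
  in the symmetric group of \<open>Hom(g,f)\<close> gives the claim. Let \<open>t\<close> be the coarsest quotient of
  \<open>dom g\<close> through which all of \<open>Hom(g,f)\<close> factors, and write \<open>g = y \<circ> t\<close>. The automorphisms of
  \<open>g\<close> permute \<open>Hom(g,f)\<close>, hence descend along \<open>t\<close>, and counting shows that \<open>y\<close> is Galois. As
  \<open>f \<sqsubseteq> y \<sqsubseteq> g\<close>, minimality of the closure forces \<open>deg t = 1\<close>, so \<open>Aut t\<close> is trivial; by \<open>G5\<close> it
  contains the kernel of the action.\<close>

section \<open>Order of the symmetric group on a finite set, and Lagrange's theorem in it\<close>

lemma card_Bij:
  assumes "finite E"
  shows "card (Bij E) = fact (card E)"
proof -
  \<comment> \<open>The two notions of permutation differ only off \<open>E\<close>: members of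
    \<open>Bij E\<close> are \<open>undefined\<close> there, while \<open>permutes\<close> demands
    the identity. Changing this default value in either direction gives mutually inverse
    maps.\<close>
  have "bij_betw (\<lambda>p. restrict p E) {p. p permutes E} (Bij E)"
  proof (rule bij_betwI[where g = "\<lambda>p x. if x \<in> E then p x else x"])
    show "(\<lambda>p. restrict p E) \<in> {p. p permutes E} \<rightarrow> Bij E"
      by (auto simp: Bij_def permutes_imp_bij cong: bij_betw_cong)
    show "(\<lambda>p x. if x \<in> E then p x else x) \<in> Bij E \<rightarrow> {p. p permutes E}"
    proof
      fix p assume "p \<in> Bij E"
      then have "bij_betw (\<lambda>x. if x \<in> E then p x else x) E E"
        by (auto simp: Bij_def cong: bij_betw_cong)
      then show "(\<lambda>x. if x \<in> E then p x else x) \<in> {p. p permutes E}"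
        by (auto intro: bij_imp_permutes)
    qed
    show "(\<lambda>x. if x \<in> E then restrict p E x else x) = p" if "p \<in> {p. p permutes E}" for p
      using that by (auto simp: permutes_def)
    show "(\<lambda>x\<in>E. if x \<in> E then p x else x) = p" if "p \<in> Bij E" for p
      using that by (auto simp: Bij_def extensional_def)
  qed
  then have "card {p. p permutes E} = card (Bij E)"
    by (rule bij_betw_same_card)
  with assms show ?thesis
    by (simp add: card_permutations)
qed

lemma card_subgroup_BijGroup_dvd:
  assumes "finite E" "subgroup H (BijGroup E)"
  shows "card H dvd fact (card E)"
proof -
  interpret group "BijGroup E" by (rule group_BijGroup)
  have "card (rcosets\<^bsub>BijGroup E\<^esub> H) * card H = fact (card E)"
    using lagrange[OF assms(2)] card_Bij[OF assms(1)] by (simp add: order_def BijGroup_def)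
  then show ?thesis
    by (metis dvd_triv_right)
qed

section \<open>Typed arrows, automorphism groups and pullbacks in an arbitrary category\<close>

context category
begin

abbreviation comp (infixr "\<cdot>" 70) where "g \<cdot> f \<equiv> Comp C g f"

text \<open>A typing judgement: composability becomes matching of objects, so associativity can be
  instantiated by chaining typing facts.\<close>

definition arr :: "'a \<Rightarrow> 'o \<Rightarrow> 'o \<Rightarrow> bool" where
  "arr f X Y \<longleftrightarrow> f \<in> Arr C \<and> Dom C f = X \<and> Cod C f = Y"

lemma arr_comp: "arr f X Y \<Longrightarrow> arr g Y Z \<Longrightarrow> arr (g \<cdot> f) X Z"
  by (simp add: arr_def Comp_in Dom_Comp Cod_Comp)

lemma arr_Id: "arr f X Y \<Longrightarrow> arr (Id C X) X X" "arr f X Y \<Longrightarrow> arr (Id C Y) Y Y"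
  by (auto simp: arr_def Id_in Dom_Id Cod_Id Dom_in Cod_in)

lemma comp_Id: "arr f X Y \<Longrightarrow> f \<cdot> Id C X = f" "arr f X Y \<Longrightarrow> Id C Y \<cdot> f = f"
  by (auto simp: arr_def Comp_Id_right Comp_Id_left)

lemma assoc: "arr f X Y \<Longrightarrow> arr g Y Z \<Longrightarrow> arr h Z W \<Longrightarrow> (h \<cdot> g) \<cdot> f = h \<cdot> (g \<cdot> f)"
  by (simp add: arr_def Comp_assoc)

lemma mem_Hom_iff: "arr g X A \<Longrightarrow> arr f Y A \<Longrightarrow> h \<in> Hom C g f \<longleftrightarrow> arr h X Y \<and> f \<cdot> h = g"
  by (auto simp: Hom_def arr_def Dom_Comp)

lemma mem_Aut_iff:
  assumes "arr f X A"
  shows "a \<in> Aut C f \<longleftrightarrow> arr a X X \<and> f \<cdot> a = f \<and> (\<exists>b. arr b X X \<and> a \<cdot> b = Id C X \<and> b \<cdot> a = Id C X)"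
  unfolding Aut_def mem_Collect_eq mem_Hom_iff[OF assms assms] Defs.iso_def inverse_arrows_def
  by (auto simp: arr_def)

text \<open>Being an isomorphism only provides an inverse \<open>b\<close> in the category. That
  \<open>b\<close> lies over \<open>f\<close> as well follows by composing
  \<open>f = f \<cdot> a\<close> with \<open>b\<close>.\<close>

lemma Aut_inverse:
  assumes f: "arr f X A" and a: "a \<in> Aut C f"
  obtains b where "b \<in> Aut C f" "a \<cdot> b = Id C X" "b \<cdot> a = Id C X"
proof -
  obtain b where b: "arr b X X" "a \<cdot> b = Id C X" "b \<cdot> a = Id C X" and a': "arr a X X" "f \<cdot> a = f"
    using a f by (auto simp: mem_Aut_iff)
  have "f \<cdot> b = (f \<cdot> a) \<cdot> b" by (simp add: a')
  also have "\<dots> = f" using assoc[OF b(1) a'(1) f] b comp_Id[OF f] by simp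
  finally have "b \<in> Aut C f" using a' b f by (auto simp: mem_Aut_iff)
  then show thesis using b that by blast
qed

lemma Aut_comp:
  assumes f: "arr f X A" and a: "a \<in> Aut C f" and b: "b \<in> Aut C f"
  shows "a \<cdot> b \<in> Aut C f"
proof -
  obtain a' where a': "a' \<in> Aut C f" "a \<cdot> a' = Id C X" "a' \<cdot> a = Id C X"
    using Aut_inverse[OF f a] .
  obtain b' where b': "b' \<in> Aut C f" "b \<cdot> b' = Id C X" "b' \<cdot> b = Id C X"
    using Aut_inverse[OF f b] .
  have ar: "arr a X X" "arr b X X" "arr a' X X" "arr b' X X" "f \<cdot> a = f" "f \<cdot> b = f"
    using a b a'(1) b'(1) f by (auto simp: mem_Aut_iff)
  have 1: "(a \<cdot> b) \<cdot> (b' \<cdot> a') = Id C X"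
    using assoc[OF arr_comp[OF ar(3,4)] ar(2,1)] assoc[OF ar(3,4,2)] a' b' comp_Id(2)[OF ar(3)]
    by simp
  have 2: "(b' \<cdot> a') \<cdot> (a \<cdot> b) = Id C X"
    using assoc[OF arr_comp[OF ar(2,1)] ar(3,4)] assoc[OF ar(2,1,3)] a' b' comp_Id(2)[OF ar(2)]
    by simp
  have "f \<cdot> (a \<cdot> b) = f"
    using assoc[OF ar(2,1) f] ar by simp
  then show ?thesis
    using 1 2 ar f by (auto simp: mem_Aut_iff intro: arr_comp)
qed

lemma Id_in_Aut: "arr f X A \<Longrightarrow> Id C X \<in> Aut C f"
  using arr_Id(1)[of f X A] comp_Id(1)[of f X A] comp_Id(1)[of "Id C X" X X]
  by (auto simp: mem_Aut_iff)

lemma pullback_ex1: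
  assumes "is_pullback C f g p q" "arr f B A" "arr g D A" "arr p U B" "arr q U D"
    and "arr u X B" "arr v X D" "f \<cdot> u = g \<cdot> v"
  shows "\<exists>!w. arr w X U \<and> p \<cdot> w = u \<and> q \<cdot> w = v"
proof -
  have "u \<in> Arr C" "v \<in> Arr C" "Dom C u = Dom C v" "Cod C u = Dom C f" "Cod C v = Dom C g"
    using assms(2,3,6,7) by (auto simp: arr_def)
  then have "\<exists>!w. w \<in> Arr C \<and> Dom C w = Dom C u \<and> Cod C w = Dom C p \<and> p \<cdot> w = u \<and> q \<cdot> w = v"
    using assms(1,8) unfolding is_pullback_def by blast
  moreover have "Dom C u = X" "Dom C p = U"
    using assms(4,6) by (auto simp: arr_def)
  ultimately show ?thesis
    by (simp add: arr_def conj_assoc)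
qed

lemma pullback_lift:
  assumes "is_pullback C f g p q" "arr f B A" "arr g D A" "arr p U B" "arr q U D"
    and "arr u X B" "arr v X D" "f \<cdot> u = g \<cdot> v"
  obtains w where "arr w X U" "p \<cdot> w = u" "q \<cdot> w = v"
  using pullback_ex1[OF assms] by blast

text \<open>Since \<open>f \<cdot> p = g \<cdot> q\<close>, the arrows \<open>p \<cdot> w\<close>
  and \<open>q \<cdot> w\<close> form a cone, and both \<open>w\<close> and \<open>w'\<close>
  mediate it.\<close>

lemma pullback_eqI:
  assumes pb: "is_pullback C f g p q" "arr f B A" "arr g D A" "arr p U B" "arr q U D"
    and w: "arr w X U" "arr w' X U" "p \<cdot> w = p \<cdot> w'" "q \<cdot> w = q \<cdot> w'"
  shows "w = w'"
proof -
  have "f \<cdot> p \<cdot> w = (f \<cdot> p) \<cdot> w" using assoc[OF w(1) pb(4,2)] by simp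
  also have "\<dots> = (g \<cdot> q) \<cdot> w" using pb(1) by (simp add: is_pullback_def)
  also have "\<dots> = g \<cdot> q \<cdot> w" using assoc[OF w(1) pb(5,3)] .
  finally have "\<exists>!z. arr z X U \<and> p \<cdot> z = p \<cdot> w \<and> q \<cdot> z = q \<cdot> w"
    using pullback_ex1[OF pb arr_comp[OF w(1) pb(4)] arr_comp[OF w(1) pb(5)]] by blast
  then show ?thesis using w by metis
qed

text \<open>Precomposition sends \<open>Aut C g\<close> into the symmetric group of
  \<open>Hom C g f\<close>, injectively by \<open>faithful\<close>. It reverses products, but its
  image is still a subgroup, and Lagrange applies to the image.\<close>

lemma card_Aut_dvd_fact:
  assumes g: "arr g G A" and f: "arr f B A" and fin: "finite (Hom C g f)"
    and faithful: "\<And>a b. a \<in> Aut C g \<Longrightarrow> b \<in> Aut C g \<Longrightarrow> (\<And>h. h \<in> Hom C g f \<Longrightarrow> h \<cdot> a = h \<cdot> b) \<Longrightarrow> a = b"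
  shows "card (Aut C g) dvd fact (card (Hom C g f))"
proof -
  let ?H = "Hom C g f"
  define \<phi> where "\<phi> a = restrict (\<lambda>h. h \<cdot> a) ?H" for a
  interpret group "BijGroup ?H" by (rule group_BijGroup)
  have arrA: "arr a G G" "g \<cdot> a = g" if "a \<in> Aut C g" for a
    using that g by (auto simp: mem_Aut_iff)
  have arrH: "arr h G B" "f \<cdot> h = g" if "h \<in> ?H" for h
    using that g f by (auto simp: mem_Hom_iff)
  have closed: "h \<cdot> a \<in> ?H" if "h \<in> ?H" "a \<in> Aut C g" for h a
    using arrA[OF that(2)] arrH[OF that(1)] assoc[of a G G h B f A] f g
    by (auto simp: mem_Hom_iff intro: arr_comp)
  have comp: "(h \<cdot> a) \<cdot> b = h \<cdot> a \<cdot> b" if "h \<in> ?H" "a \<in> Aut C g" "b \<in> Aut C g" for h a b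
    using arrA[OF that(2)] arrA[OF that(3)] arrH[OF that(1)] by (simp add: assoc)
  have bij: "\<phi> a \<in> Bij ?H" if a: "a \<in> Aut C g" for a
  proof -
    obtain b where b: "b \<in> Aut C g" "a \<cdot> b = Id C G" "b \<cdot> a = Id C G"
      using Aut_inverse[OF g a] .
    have "bij_betw (\<lambda>h. h \<cdot> a) ?H ?H"
      by (rule bij_betwI[where g = "\<lambda>h. h \<cdot> b"])
        (use a b closed comp comp_Id(1)[OF arrH(1)] in auto)
    then show ?thesis
      by (auto simp: Bij_def \<phi>_def cong: bij_betw_cong)
  qed
  have \<phi>_comp: "\<phi> b \<otimes>\<^bsub>BijGroup ?H\<^esub> \<phi> a = \<phi> (a \<cdot> b)" if "a \<in> Aut C g" "b \<in> Aut C g" for a b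
    using that bij closed comp by (auto simp: BijGroup_def compose_def \<phi>_def fun_eq_iff)
  have \<phi>_Id: "\<phi> (Id C G) = \<one>\<^bsub>BijGroup ?H\<^esub>"
    by (auto simp: BijGroup_def \<phi>_def fun_eq_iff comp_Id(1)[OF arrH(1)])
  have carr: "\<phi> a \<in> carrier (BijGroup ?H)" if "a \<in> Aut C g" for a
    using bij[OF that] by (simp add: BijGroup_def)
  have "subgroup (\<phi> ` Aut C g) (BijGroup ?H)"
  proof (rule subgroupI)
    show "\<phi> ` Aut C g \<subseteq> carrier (BijGroup ?H)" using carr by auto
    show "\<phi> ` Aut C g \<noteq> {}" using Id_in_Aut[OF g] by auto
  next
    fix s assume "s \<in> \<phi> ` Aut C g"
    then obtain a where a: "a \<in> Aut C g" "s = \<phi> a" by auto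
    obtain b where b: "b \<in> Aut C g" "a \<cdot> b = Id C G" "b \<cdot> a = Id C G"
      using Aut_inverse[OF g a(1)] .
    have "inv\<^bsub>BijGroup ?H\<^esub> s = \<phi> b"
      using a b carr \<phi>_comp \<phi>_Id by (intro inv_equality) auto
    then show "inv\<^bsub>BijGroup ?H\<^esub> s \<in> \<phi> ` Aut C g" using b by auto
  next
    fix s s' assume "s \<in> \<phi> ` Aut C g" "s' \<in> \<phi> ` Aut C g"
    then show "s \<otimes>\<^bsub>BijGroup ?H\<^esub> s' \<in> \<phi> ` Aut C g"
      using \<phi>_comp Aut_comp[OF g] by auto
  qed
  then have "card (\<phi> ` Aut C g) dvd fact (card ?H)"
    using card_subgroup_BijGroup_dvd fin by blast
  moreover have "inj_on \<phi> (Aut C g)"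
  proof (rule inj_onI)
    fix a b assume ab: "a \<in> Aut C g" "b \<in> Aut C g" "\<phi> a = \<phi> b"
    have "h \<cdot> a = h \<cdot> b" if "h \<in> ?H" for h
      using fun_cong[OF ab(3), of h] that by (simp add: \<phi>_def)
    with ab(1,2) show "a = b" by (rule faithful)
  qed
  ultimately show ?thesis
    by (simp add: card_image)
qed

end

section \<open>Degrees, bounds on \<open>Hom\<close> and \<open>Aut\<close>, and descent of the
  Galois property\<close>

context covering_setting
begin

lemma cover_iff: "cover C S f \<longleftrightarrow> f \<in> Arr C \<and> Dom C f \<in> S \<and> Cod C f \<in> S"
  by (simp add: cover_def full_subcat_def)

lemma cover_arr: "arr f X Y \<Longrightarrow> X \<in> S \<Longrightarrow> Y \<in> S \<Longrightarrow> cover C S f"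
  by (simp add: cover_iff arr_def)

lemma coverE:
  assumes "cover C S f"
  obtains X Y where "arr f X Y" "X \<in> S" "Y \<in> S"
  using assms by (auto simp: cover_iff arr_def)

lemma cancel_right:
  assumes "arr t X Y" "X \<in> S" "Y \<in> S" "arr u Y Z" "arr v Y Z" "u \<cdot> t = v \<cdot> t"
  shows "u = v"
  using G2_II[of t] assms by (auto simp: full_subcat_def epic_def arr_def)

lemma deg_comp: "arr f X Y \<Longrightarrow> arr g Y Z \<Longrightarrow> Y \<in> S \<Longrightarrow> Z \<in> S \<Longrightarrow> deg (g \<cdot> f) = deg g * deg f"
  using G4_I by (auto simp: arr_def)

lemma deg_pos: "arr f X Y \<Longrightarrow> Y \<in> S \<Longrightarrow> deg f > 0"
  using G4_pos by (auto simp: arr_def)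

lemma pullback_ex:
  assumes "arr f B A" "arr g D A" "A \<in> S" "B \<in> S" "D \<in> S"
  obtains p q U where "is_pullback C f g p q" "arr p U B" "arr q U D" "deg f = deg q"
proof -
  have fg: "f \<in> Arr (full_subcat C S)" "g \<in> Arr (full_subcat C S)"
    using assms by (auto simp: full_subcat_def arr_def)
  then obtain p q where pb: "is_pullback C f g p q"
    using G1 assms by (metis arr_def)
  have "arr p (Dom C p) B" "arr q (Dom C p) D"
    using pb assms by (auto simp: is_pullback_def arr_def)
  with pb G4_III[OF fg pb] that show thesis by blast
qed

lemma \<Sigma>_arr:
  assumes "arr w X U" "i \<in> \<Sigma> U"
  obtains Y where "arr i Y U" "Y \<in> S"
  using assms Cod_in G3_arrows by (auto simp: arr_def)

lemma \<Sigma>_factor: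
  assumes "arr w X U" "X \<in> S"
  obtains i Y t where "i \<in> \<Sigma> U" "arr i Y U" "Y \<in> S" "arr t X Y" "i \<cdot> t = w"
proof -
  obtain i where i: "i \<in> \<Sigma> U" "Hom C w i \<noteq> {}"
    using G3_unique[of U w] assms Cod_in by (auto simp: arr_def)
  obtain Y where Y: "arr i Y U" "Y \<in> S" using \<Sigma>_arr[OF assms(1) i(1)] .
  then show thesis using that i mem_Hom_iff[OF assms(1)] by blast
qed

lemma \<Sigma>_unique:
  assumes "arr w X U" "X \<in> S" "i \<in> \<Sigma> U" "j \<in> \<Sigma> U" "arr i Y U" "arr j Z U"
    and "arr t X Y" "arr u X Z" "i \<cdot> t = w" "j \<cdot> u = w"
  shows "i = j"
proof -
  have "Hom C w i \<noteq> {}" "Hom C w j \<noteq> {}"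
    using assms mem_Hom_iff by blast+
  then show ?thesis
    using G3_unique[of U w] assms Cod_in by (auto simp: arr_def)
qed

text \<open>An arrow \<open>h\<close> with \<open>g = f \<circ> h\<close> is a section of the pullback \<open>q\<close> of \<open>f\<close> along \<open>g\<close>. A section
  passes through one component \<open>i\<close> in \<open>\<Sigma>\<close>, on which \<open>q \<circ> i\<close> is invertible because all arrows are
  epic, so \<open>i\<close> determines it. As \<open>deg f = deg q\<close> is a sum of positive numbers over the components,
  there are at most \<open>deg f\<close> of them.\<close>

lemma card_Hom_le:
  assumes f: "arr f B A" and g: "arr g G A" and S: "A \<in> S" "B \<in> S" "G \<in> S"
  shows "finite (Hom C g f)" and "card (Hom C g f) \<le> deg f"
proof -
  obtain p q U where pb: "is_pullback C f g p q" and p: "arr p U B" and q: "arr q U G"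
    and dq: "deg f = deg q"
    using pullback_ex[OF f g S] .
  \<comment> \<open>The composite \<open>i \<cdot> t\<close> is a section of \<open>q\<close> whose
    other projection is \<open>h\<close>; thus \<open>P h i\<close> records that a section belonging
    to \<open>h\<close> runs through the component \<open>i\<close>.\<close>
  define P where "P h i \<longleftrightarrow> i \<in> \<Sigma> U \<and>
    (\<exists>Y t. arr i Y U \<and> Y \<in> S \<and> arr t G Y \<and> p \<cdot> i \<cdot> t = h \<and> q \<cdot> i \<cdot> t = Id C G)" for h i
  have ex: "\<exists>i. P h i" if "h \<in> Hom C g f" for h
  proof -
    have h: "arr h G B" "f \<cdot> h = g" using that f g by (auto simp: mem_Hom_iff)
    have "f \<cdot> h = g \<cdot> Id C G" using h comp_Id[OF g] by simp
    then obtain w where w: "arr w G U" "p \<cdot> w = h" "q \<cdot> w = Id C G"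
      using pullback_lift[OF pb f g p q h(1) arr_Id(1)[OF g]] by blast
    then show ?thesis
      unfolding P_def using \<Sigma>_factor[OF w(1) S(3)] by metis
  qed
  have uniq: "h = h'" if "P h i" "P h' i" for h h' i
  proof -
    obtain Y t where t: "arr i Y U" "Y \<in> S" "arr t G Y" "p \<cdot> i \<cdot> t = h" "q \<cdot> i \<cdot> t = Id C G"
      using \<open>P h i\<close> unfolding P_def by blast
    obtain t' where t': "arr t' G Y" "p \<cdot> i \<cdot> t' = h'" "q \<cdot> i \<cdot> t' = Id C G"
      using \<open>P h' i\<close> t(1) unfolding P_def arr_def by blast
    let ?r = "q \<cdot> i"
    have r: "arr ?r Y G" using t q by (auto intro: arr_comp)
    have rt: "?r \<cdot> t = Id C G" "?r \<cdot> t' = Id C G"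
      using t t' assoc[OF _ t(1) q] by auto
    \<comment> \<open>A section \<open>t\<close> of \<open>?r\<close> becomes a two-sided inverse:
      \<open>t \<cdot> ?r \<cdot> t = t\<close>, and \<open>t\<close> is epic. Hence
      \<open>?r\<close> has only this one section.\<close>
    have "(t \<cdot> ?r) \<cdot> t = Id C Y \<cdot> t"
      using assoc[OF t(3) r t(3)] rt comp_Id[OF t(3)] by simp
    then have "t \<cdot> ?r = Id C Y"
      using cancel_right[OF t(3) S(3) t(2) arr_comp[OF r t(3)] arr_Id(2)[OF t(3)]] by simp
    then have "t' = (t \<cdot> ?r) \<cdot> t'" using comp_Id[OF t'(1)] by simp
    also have "\<dots> = t" using assoc[OF t'(1) r t(3)] rt comp_Id[OF t(3)] by simp
    finally show ?thesis using t t' by simp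
  qed
  define I where "I h = (SOME i. P h i)" for h
  have I: "P h (I h)" if "h \<in> Hom C g f" for h
    unfolding I_def using someI_ex[OF ex[OF that]] .
  have inj: "inj_on I (Hom C g f)"
    using I uniq by (metis inj_onI)
  have sub: "I ` Hom C g f \<subseteq> \<Sigma> U"
    using I by (auto simp: P_def)
  have fin: "finite (\<Sigma> U)" and dsum: "deg q = (\<Sum>i\<in>\<Sigma> U. deg (q \<cdot> i))"
    using G4_II[of q] q S by (auto simp: arr_def)
  show "finite (Hom C g f)"
    using inj sub fin by (metis finite_imageD finite_subset)
  have "card (Hom C g f) \<le> card (\<Sigma> U)"
    using inj sub fin by (rule card_inj_on_le)
  also have "\<dots> = (\<Sum>i\<in>\<Sigma> U. 1)" by simp
  also have "\<dots> \<le> (\<Sum>i\<in>\<Sigma> U. deg (q \<cdot> i))"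
  proof (rule sum_mono)
    fix i assume "i \<in> \<Sigma> U"
    then obtain Y where "arr i Y U"
      by (rule \<Sigma>_arr[OF arr_Id(1)[OF p]])
    then show "1 \<le> deg (q \<cdot> i)"
      using deg_pos[OF arr_comp[OF _ q] S(3)] by (simp add: Suc_le_eq)
  qed
  finally show "card (Hom C g f) \<le> deg f" using dq dsum by simp
qed

lemma card_Aut_le:
  assumes f: "arr f B A" and S: "A \<in> S" "B \<in> S"
  shows "finite (Aut C f)" and "card (Aut C f) \<le> deg f"
proof -
  have "Aut C f \<subseteq> Hom C f f" by (auto simp: Aut_def)
  with card_Hom_le[OF f f S(1,2,2)] show "finite (Aut C f)" "card (Aut C f) \<le> deg f"
    using finite_subset card_mono by (blast, meson order_trans)
qed

text \<open>Descending automorphisms along \<open>t\<close> is a map from \<open>Aut (y \<circ> t)\<close> to \<open>Aut y\<close> whose fibres embed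
  into \<open>Aut t\<close>, so \<open>deg y * deg t \<le> |Aut y| * deg t\<close>.\<close>

lemma galois_descend:
  assumes t: "arr t G Y" and y: "arr y Y A" and S: "G \<in> S" "Y \<in> S" "A \<in> S"
    and galois: "galois_cover C S deg (y \<cdot> t)"
    and desc: "\<And>a. a \<in> Aut C (y \<cdot> t) \<Longrightarrow> \<exists>b. arr b Y Y \<and> t \<cdot> a = b \<cdot> t"
  shows "galois_cover C S deg y"
proof -
  let ?g = "y \<cdot> t"
  have g: "arr ?g G A" using arr_comp[OF t y] .
  have arrA: "arr a G G" "?g \<cdot> a = ?g" if "a \<in> Aut C ?g" for a
    using that g by (auto simp: mem_Aut_iff)
  \<comment> \<open>The endomorphism of \<open>Y\<close> induced by \<open>a\<close> along
    \<open>t\<close>. Cancelling the epic \<open>t\<close> transfers equations from \<open>G\<close>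
    to \<open>Y\<close>: inverse pairs go to inverse pairs, and \<open>y\<close> is
    preserved.\<close>
  define \<phi> where "\<phi> a = (SOME b. arr b Y Y \<and> t \<cdot> a = b \<cdot> t)" for a
  have \<phi>: "arr (\<phi> a) Y Y" "t \<cdot> a = \<phi> a \<cdot> t" if "a \<in> Aut C ?g" for a
    using someI_ex[OF desc[OF that]] by (auto simp: \<phi>_def)
  note cancel = cancel_right[OF t S(1,2)]
  have inv: "\<phi> a \<cdot> \<phi> b = Id C Y" if "a \<in> Aut C ?g" "b \<in> Aut C ?g" "a \<cdot> b = Id C G" for a b
  proof (rule cancel)
    have "(\<phi> a \<cdot> \<phi> b) \<cdot> t = \<phi> a \<cdot> t \<cdot> b"
      using assoc[OF t \<phi>(1)[OF that(2)] \<phi>(1)[OF that(1)]] \<phi>(2)[OF that(2)] by simp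
    also have "\<dots> = (\<phi> a \<cdot> t) \<cdot> b"
      using assoc[OF arrA(1)[OF that(2)] t \<phi>(1)[OF that(1)]] by simp
    also have "\<dots> = t \<cdot> a \<cdot> b"
      using assoc[OF arrA(1)[OF that(2)] arrA(1)[OF that(1)] t] \<phi>(2)[OF that(1)] by simp
    finally show "(\<phi> a \<cdot> \<phi> b) \<cdot> t = Id C Y \<cdot> t"
      using that(3) comp_Id[OF t] by simp
  qed (use that \<phi> arr_comp arr_Id[OF t] in blast)+
  have im: "\<phi> a \<in> Aut C y" if a: "a \<in> Aut C ?g" for a
  proof -
    obtain b where b: "b \<in> Aut C ?g" "a \<cdot> b = Id C G" "b \<cdot> a = Id C G"
      using Aut_inverse[OF g a] .
    have "(y \<cdot> \<phi> a) \<cdot> t = y \<cdot> t \<cdot> a"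
      using assoc[OF t \<phi>(1)[OF a] y] \<phi>(2)[OF a] by simp
    also have "\<dots> = y \<cdot> t"
      using assoc[OF arrA(1)[OF a] t y] arrA(2)[OF a] by simp
    finally have "y \<cdot> \<phi> a = y"
      using cancel arr_comp[OF \<phi>(1)[OF a] y] y by blast
    then show ?thesis
      using inv[OF a b(1,2)] inv[OF b(1) a b(3)] \<phi>(1) a b(1) y by (auto simp: mem_Aut_iff)
  qed
  let ?F = "\<lambda>b. {a \<in> Aut C ?g. \<phi> a = b}"
  have fibre: "card (?F b) \<le> deg t" for b
  proof (cases "?F b = {}")
    case False
    then obtain c where c: "c \<in> Aut C ?g" "\<phi> c = b" by auto
    obtain d where d: "d \<in> Aut C ?g" "c \<cdot> d = Id C G" "d \<cdot> c = Id C G"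
      using Aut_inverse[OF g c(1)] .
    \<comment> \<open>On the fibre of \<open>c\<close>, \<open>t \<cdot> a = t \<cdot> c\<close>.
      Translating by the inverse \<open>d\<close> of \<open>c\<close> therefore moves the fibre
      injectively into \<open>Aut C t\<close>, which has at most \<open>deg t\<close>
      elements.\<close>
    have "a \<cdot> d \<in> Aut C t" if a: "a \<in> ?F b" for a
    proof -
      have a': "a \<in> Aut C ?g" "t \<cdot> a = t \<cdot> c" using a c \<phi>(2) by auto
      have "t \<cdot> a \<cdot> d = (t \<cdot> a) \<cdot> d"
        using assoc[OF arrA(1)[OF d(1)] arrA(1)[OF a'(1)] t] by simp
      also have "\<dots> = t"
        using assoc[OF arrA(1)[OF d(1)] arrA(1)[OF c(1)] t] a'(2) d comp_Id[OF t] by simp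
      finally show ?thesis
        using Aut_comp[OF g a'(1) d(1)] g t by (auto simp: mem_Aut_iff)
    qed
    moreover have "inj_on (\<lambda>a. a \<cdot> d) (?F b)"
    proof (rule inj_onI)
      have "(a \<cdot> d) \<cdot> c = a" if "a \<in> Aut C ?g" for a
        using assoc[OF arrA(1)[OF c(1)] arrA(1)[OF d(1)] arrA(1)[OF that]] d
          comp_Id[OF arrA(1)[OF that]] by simp
      then show "a = a'" if "a \<in> ?F b" "a' \<in> ?F b" "a \<cdot> d = a' \<cdot> d" for a a'
        using that by (metis (no_types, lifting) mem_Collect_eq)
    qed
    ultimately have "card (?F b) \<le> card (Aut C t)"
      using card_inj_on_le[of "\<lambda>a. a \<cdot> d"] card_Aut_le(1)[OF t S(2,1)] by blast
    then show ?thesis using card_Aut_le(2)[OF t S(2,1)] by simp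
  qed (simp only: card.empty le0)
  have "Aut C ?g = (\<Union>b\<in>Aut C y. ?F b)" using im by auto
  then have "card (Aut C ?g) \<le> (\<Sum>b\<in>Aut C y. card (?F b))"
    using card_UN_le[OF card_Aut_le(1)[OF y S(3,2)], of ?F] by simp
  also have "\<dots> \<le> card (Aut C y) * deg t"
    using fibre sum_bounded_above[of "Aut C y" "\<lambda>b. card (?F b)" "deg t"] by simp
  finally have "deg y * deg t \<le> card (Aut C y) * deg t"
    using galois deg_comp[OF t y S(2,3)] by (simp add: galois_cover_def)
  then have "deg y \<le> card (Aut C y)"
    using deg_pos[OF t S(2)] by simp
  then show ?thesis
    using card_Aut_le(2)[OF y S(3,2)] cover_arr[OF y S(2,3)] by (simp add: galois_cover_def)
qed

section \<open>Factorization through an arrow, and joint images\<close>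

definition through :: "'a \<Rightarrow> 'a \<Rightarrow> bool" where
  "through x h \<longleftrightarrow> (\<exists>k. arr k (Cod C x) (Cod C h) \<and> h = k \<cdot> x)"

lemma throughE:
  assumes "through x h" "arr x X Y" "arr h X B"
  obtains k where "arr k Y B" "h = k \<cdot> x"
  using assms by (auto simp: through_def arr_def)

lemma throughI:
  assumes "arr x X Y" "arr k Y B" "h = k \<cdot> x"
  shows "through x h"
  using arr_comp[OF assms(1,2)] assms by (auto simp: through_def arr_def)

lemma through_trans:
  assumes "through x t" "through t h" "arr x X Y" "arr t X Z" "arr h X B"
  shows "through x h"
proof -
  obtain k where k: "arr k Y Z" "t = k \<cdot> x" using throughE[OF assms(1,3,4)] .
  obtain l where l: "arr l Z B" "h = l \<cdot> t" using throughE[OF assms(2,4,5)] .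
  show ?thesis
    using throughI[OF assms(3) arr_comp[OF k(1) l(1)]] assoc[OF assms(3) k(1) l(1)] k l by simp
qed

text \<open>Up to isomorphism \<open>t\<close> is the image of \<open>G\<close> in the fibre product of the codomains of \<open>F\<close>. The
  last clause says that \<open>F\<close> is jointly monic on that image; it is where \<open>G5\<close> enters.\<close>

definition joint_image :: "'o \<Rightarrow> 'a set \<Rightarrow> 'a \<Rightarrow> bool" where
  "joint_image G F t \<longleftrightarrow> (\<forall>h\<in>F. through t h) \<and>
     (\<forall>x Z. arr x G Z \<longrightarrow> Z \<in> S \<longrightarrow> (\<forall>h\<in>F. through x h) \<longrightarrow> through x t) \<and>
     (\<forall>a b Z. arr a Z G \<longrightarrow> arr b Z G \<longrightarrow> (\<forall>h\<in>F. h \<cdot> a = h \<cdot> b) \<longrightarrow> t \<cdot> a = t \<cdot> b)"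

end

section \<open>Existence of joint images when components are monic\<close>

locale mono_covering_setting = covering_setting +
  assumes G5: "U \<in> Obj C \<Longrightarrow> i \<in> \<Sigma> U \<Longrightarrow> monic C i"
begin

lemma \<Sigma>_cancel:
  assumes "i \<in> \<Sigma> U" "arr i Y U" "arr u X Y" "arr v X Y" "i \<cdot> u = i \<cdot> v"
  shows "u = v"
  using G5[of U i] assms Cod_in by (auto simp: monic_def arr_def)

text \<open>The pair \<open>x1\<close>, \<open>x2\<close> is one arrow \<open>w\<close> into the
  pullback \<open>U\<close> of \<open>y1\<close> and \<open>y2\<close>, and \<open>t\<close> is its
  factor through the component \<open>i\<close> of \<open>U\<close>. As \<open>i\<close> is monic,
  arrows into \<open>Y\<close> are separated by the two projections, which gives joint
  monicity.\<close>

lemma joint_image_pair: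
  assumes x1: "arr x1 G Y1" and x2: "arr x2 G Y2" and y1: "arr y1 Y1 A" and y2: "arr y2 Y2 A"
    and S: "G \<in> S" "Y1 \<in> S" "Y2 \<in> S" "A \<in> S" and eq: "y1 \<cdot> x1 = y2 \<cdot> x2"
  obtains Y t where "arr t G Y" "Y \<in> S" "joint_image G {x1, x2} t"
proof -
  obtain p q U where pb: "is_pullback C y1 y2 p q" and p: "arr p U Y1" and q: "arr q U Y2"
    using pullback_ex[OF y1 y2 S(4,2,3)] .
  obtain w where w: "arr w G U" "p \<cdot> w = x1" "q \<cdot> w = x2"
    using pullback_lift[OF pb y1 y2 p q x1 x2 eq] .
  obtain i Y t where i: "i \<in> \<Sigma> U" "arr i Y U" "Y \<in> S" and t: "arr t G Y" "i \<cdot> t = w"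
    using \<Sigma>_factor[OF w(1) S(1)] .
  have through1: "through t x1"
    using throughI[OF t(1) arr_comp[OF i(2) p]] assoc[OF t(1) i(2) p] t w by simp
  have through2: "through t x2"
    using throughI[OF t(1) arr_comp[OF i(2) q]] assoc[OF t(1) i(2) q] t w by simp
  have univ: "through x t" if x: "arr x G Z" and Z: "Z \<in> S" and th: "through x x1" "through x x2" for x Z
  proof -
    obtain k1 where k1: "arr k1 Z Y1" "x1 = k1 \<cdot> x" using throughE[OF th(1) x x1] .
    obtain k2 where k2: "arr k2 Z Y2" "x2 = k2 \<cdot> x" using throughE[OF th(2) x x2] .
    \<comment> \<open>Cancelling the epic \<open>x\<close> turns the two factors \<open>k1\<close>,
      \<open>k2\<close> into a cone, so the competitor \<open>Z\<close> itself maps to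
      \<open>U\<close>.\<close>
    have "(y1 \<cdot> k1) \<cdot> x = (y2 \<cdot> k2) \<cdot> x"
      using assoc[OF x k1(1) y1] assoc[OF x k2(1) y2] k1 k2 eq by simp
    then have "y1 \<cdot> k1 = y2 \<cdot> k2"
      using cancel_right[OF x S(1) Z arr_comp[OF k1(1) y1] arr_comp[OF k2(1) y2]] by simp
    then obtain v where v: "arr v Z U" "p \<cdot> v = k1" "q \<cdot> v = k2"
      using pullback_lift[OF pb y1 y2 p q k1(1) k2(1)] by blast
    have "v \<cdot> x = w"
      using pullback_eqI[OF pb y1 y2 p q arr_comp[OF x v(1)] w(1)]
        assoc[OF x v(1) p] assoc[OF x v(1) q] v k1 k2 w by simp
    obtain j X u where j: "j \<in> \<Sigma> U" "arr j X U" "X \<in> S" and u: "arr u Z X" "j \<cdot> u = v"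
      using \<Sigma>_factor[OF v(1) Z] .
    have ju: "j \<cdot> u \<cdot> x = w"
      using assoc[OF x u(1) j(2)] u(2) \<open>v \<cdot> x = w\<close> by simp
    \<comment> \<open>The arrow \<open>w\<close> factors through both components, by
      \<open>t\<close> and by \<open>u \<cdot> x\<close>, so the uniqueness in \<open>G3\<close>
      identifies them. Then \<open>i\<close> monic yields \<open>t = u \<cdot> x\<close>.\<close>
    have "i = j"
      using \<Sigma>_unique[OF w(1) S(1) i(1) j(1) i(2) j(2) t(1) arr_comp[OF x u(1)] t(2) ju] .
    then have "X = Y" using i(2) j(2) by (simp add: arr_def)
    have "t = u \<cdot> x"
      using \<Sigma>_cancel[OF i(1,2) t(1)] arr_comp[OF x u(1)] ju t(2) \<open>i = j\<close> \<open>X = Y\<close> by simp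
    then show ?thesis using throughI[OF x u(1)] by simp
  qed
  have "t \<cdot> a = t \<cdot> b" if a: "arr a Z G" "arr b Z G" "x1 \<cdot> a = x1 \<cdot> b" "x2 \<cdot> a = x2 \<cdot> b" for a b Z
  proof -
    have "w \<cdot> a = w \<cdot> b"
      using pullback_eqI[OF pb y1 y2 p q arr_comp[OF a(1) w(1)] arr_comp[OF a(2) w(1)]]
        assoc[OF a(1) w(1) p] assoc[OF a(2) w(1) p] assoc[OF a(1) w(1) q] assoc[OF a(2) w(1) q]
        w a by simp
    then show ?thesis
      using \<Sigma>_cancel[OF i(1,2) arr_comp[OF a(1) t(1)] arr_comp[OF a(2) t(1)]]
        assoc[OF a(1) t(1) i(2)] assoc[OF a(2) t(1) i(2)] t by simp
  qed
  then have "joint_image G {x1, x2} t"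
    unfolding joint_image_def using through1 through2 univ by blast
  then show thesis using that t(1) i(3) by blast
qed

text \<open>Induction on \<open>F\<close>: the joint image of \<open>insert h F\<close> is that of
  the pair formed by \<open>h\<close> and the joint image of \<open>F\<close>.\<close>

lemma joint_image_ex:
  assumes "finite F" "F \<noteq> {}" "F \<subseteq> Hom C g f"
    and f: "arr f B A" and g: "arr g G A" and S: "A \<in> S" "B \<in> S" "G \<in> S"
  shows "\<exists>t Y. arr t G Y \<and> Y \<in> S \<and> joint_image G F t"
  using assms(1-3)
proof (induction rule: finite_ne_induct)
  case (singleton h)
  then have h: "arr h G B" using f g by (auto simp: mem_Hom_iff)
  have "joint_image G {h} h"
    unfolding joint_image_def using throughI[OF h arr_Id(2)[OF h]] comp_Id[OF h] by auto
  then show ?case using h S by blast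
next
  case (insert h F)
  then obtain t Y where t: "arr t G Y" "Y \<in> S" "joint_image G F t" by auto
  have F: "arr k G B" "f \<cdot> k = g" if "k \<in> insert h F" for k
    using insert.prems that f g by (auto simp: mem_Hom_iff)
  obtain k where k: "k \<in> F" using insert.hyps by auto
  with t have "through t k" by (auto simp: joint_image_def)
  then obtain l where l: "arr l Y B" "k = l \<cdot> t" using throughE t(1) F k by blast
  \<comment> \<open>Both sides equal \<open>g\<close>. This is the commuting square that
    \<open>joint_image_pair\<close> requires of \<open>t\<close> and \<open>h\<close>.\<close>
  have "(f \<cdot> l) \<cdot> t = f \<cdot> h"
    using assoc[OF t(1) l(1) f] l(2) F k by auto
  then obtain Z s where s: "arr s G Z" "Z \<in> S" "joint_image G {t, h} s"
    using joint_image_pair[OF t(1) F(1) arr_comp[OF l(1) f] f] S t(2) by blast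
  have h: "arr h G B" using F by blast
  have "joint_image G (insert h F) s"
    unfolding joint_image_def
  proof (intro conjI ballI allI impI)
    fix k' assume k': "k' \<in> insert h F"
    have "through s h" "through s t" using s by (auto simp: joint_image_def)
    then show "through s k'"
      using k' t through_trans[OF _ _ s(1) t(1) F(1)] by (auto simp: joint_image_def)
  next
    fix x Z' assume x: "arr x G Z'" "Z' \<in> S" "\<forall>h\<in>insert h F. through x h"
    then have "through x t" using t(3) by (auto simp: joint_image_def)
    then show "through x s" using s(3) x by (auto simp: joint_image_def)
  next
    fix a b Z' assume a: "arr a Z' G" "arr b Z' G" "\<forall>h\<in>insert h F. h \<cdot> a = h \<cdot> b"
    then have "t \<cdot> a = t \<cdot> b" using t(3) unfolding joint_image_def by blast
    then show "s \<cdot> a = s \<cdot> b" using s(3) a unfolding joint_image_def by blast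
  qed
  then show ?case using s by blast
qed

section \<open>Faithfulness of the action, and the divisibility\<close>

lemma galois_closure_faithful:
  assumes f: "arr f B A" and g: "arr g G A" and S: "A \<in> S" "B \<in> S" "G \<in> S"
    and closure: "galois_closure C S deg f g"
    and ab: "a \<in> Aut C g" "b \<in> Aut C g" "\<And>h. h \<in> Hom C g f \<Longrightarrow> h \<cdot> a = h \<cdot> b"
  shows "a = b"
proof -
  let ?H = "Hom C g f"
  have galois: "galois_cover C S deg g" and ne: "?H \<noteq> {}"
    using closure by (auto simp: galois_closure_def below_def)
  have arrH: "arr h G B" "f \<cdot> h = g" if "h \<in> ?H" for h
    using that g f by (auto simp: mem_Hom_iff)
  have arrA: "arr a G G" "g \<cdot> a = g" if "a \<in> Aut C g" for a
    using that g by (auto simp: mem_Aut_iff)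
  obtain t Y where t: "arr t G Y" "Y \<in> S" "joint_image G ?H t"
    using joint_image_ex[OF card_Hom_le(1)[OF f g S] ne subset_refl f g S] by blast
  obtain h where h: "h \<in> ?H" using ne by auto
  with t obtain k where k: "arr k Y B" "h = k \<cdot> t"
    using throughE arrH by (metis joint_image_def)
  \<comment> \<open>The intermediate cover: \<open>g = f \<cdot> h = f \<cdot> k \<cdot> t\<close>,
    so \<open>y\<close> lies above \<open>f\<close> through \<open>k\<close> and below
    \<open>g\<close> through \<open>t\<close>.\<close>
  define y where "y = f \<cdot> k"
  have y: "arr y Y A" using arr_comp[OF k(1) f] by (simp add: y_def)
  have yt: "y \<cdot> t = g"
    using assoc[OF t(1) k(1) f] arrH[OF h] k by (simp add: y_def)
  \<comment> \<open>With \<open>b\<close> inverse to \<open>a\<close>, each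
    \<open>h = (h \<cdot> a) \<cdot> b\<close> factors through \<open>t \<cdot> b\<close>, because
    \<open>h \<cdot> a\<close> is again in \<open>?H\<close> and factors through \<open>t\<close>.
    Universality of \<open>t\<close> gives \<open>t = c \<cdot> t \<cdot> b\<close>, and composing
    with \<open>a\<close> leaves \<open>t \<cdot> a = c \<cdot> t\<close>.\<close>
  have desc: "\<exists>b. arr b Y Y \<and> t \<cdot> a = b \<cdot> t" if a: "a \<in> Aut C g" for a
  proof -
    obtain b where b: "b \<in> Aut C g" "a \<cdot> b = Id C G" "b \<cdot> a = Id C G"
      using Aut_inverse[OF g a] .
    note ab = arrA(1)[OF a] arrA(1)[OF b(1)]
    have tb: "arr (t \<cdot> b) G Y" using arr_comp[OF ab(2) t(1)] .
    have "through (t \<cdot> b) h" if h: "h \<in> ?H" for h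
    proof -
      have ha: "arr (h \<cdot> a) G B" using arr_comp[OF ab(1) arrH(1)[OF h]] .
      have "h \<cdot> a \<in> ?H"
        using ha assoc[OF ab(1) arrH(1)[OF h] f] arrH(2)[OF h] arrA(2)[OF a] f g
        by (simp add: mem_Hom_iff)
      then obtain k where k: "arr k Y B" "h \<cdot> a = k \<cdot> t"
        using throughE[OF _ t(1) ha] t(3) by (metis joint_image_def)
      have "h = (h \<cdot> a) \<cdot> b"
        using assoc[OF ab(2,1) arrH(1)[OF h]] b comp_Id[OF arrH(1)[OF h]] by simp
      also have "\<dots> = k \<cdot> t \<cdot> b"
        using assoc[OF ab(2) t(1) k(1)] k(2) by simp
      finally show ?thesis by (rule throughI[OF tb k(1)])
    qed
    then have "through (t \<cdot> b) t"
      using t tb unfolding joint_image_def by blast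
    then obtain c where c: "arr c Y Y" "t = c \<cdot> t \<cdot> b"
      using throughE tb t(1) by metis
    have "t \<cdot> a = (c \<cdot> t \<cdot> b) \<cdot> a" using c(2) by simp
    also have "\<dots> = c \<cdot> (t \<cdot> b) \<cdot> a" using assoc[OF ab(1) tb c(1)] .
    also have "\<dots> = c \<cdot> t"
      using assoc[OF ab t(1)] b comp_Id[OF t(1)] by simp
    finally show ?thesis using c(1) by blast
  qed
  have "galois_cover C S deg y"
    using galois_descend[OF t(1) y S(3) t(2) S(1)] galois desc by (simp add: yt)
  moreover have "below C f y"
    using f y k(1) y_def mem_Hom_iff[OF y f] by (auto simp: below_def arr_def)
  moreover have "below C y g"
    using g y t(1) yt mem_Hom_iff[OF g y] by (auto simp: below_def arr_def)
  ultimately have "below C g y"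
    using closure by (auto simp: galois_closure_def)
  then obtain z where z: "arr z Y G" "g \<cdot> z = y"
    using mem_Hom_iff[OF y g] by (auto simp: below_def)
  \<comment> \<open>From \<open>y = g \<cdot> z = y \<cdot> t \<cdot> z\<close>. Degrees are
    positive integers, so \<open>deg t\<close> must be 1.\<close>
  have "deg y = deg y * deg t * deg z"
    using deg_comp[OF z(1) g S(3,1)] deg_comp[OF t(1) y t(2) S(1)] z(2) yt by simp
  then have "deg t = 1"
    using deg_pos[OF y S(1)] by (simp add: mult.assoc)
  then have Aut_t: "card (Aut C t) \<le> 1" "finite (Aut C t)"
    using card_Aut_le[OF t(1,2) S(3)] by auto
  obtain c where c: "c \<in> Aut C g" "b \<cdot> c = Id C G" "c \<cdot> b = Id C G"
    using Aut_inverse[OF g ab(2)] .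
  note abc = arrA(1)[OF ab(1)] arrA(1)[OF ab(2)] arrA(1)[OF c(1)]
  \<comment> \<open>Joint monicity applied to two automorphisms acting alike on \<open>?H\<close>;
    with \<open>c\<close> inverse to \<open>b\<close>, the arrow \<open>a \<cdot> c\<close> then
    lies in the trivial group \<open>Aut C t\<close>.\<close>
  have "t \<cdot> a = t \<cdot> b"
    using t(3) ab abc unfolding joint_image_def by blast
  then have "t \<cdot> a \<cdot> c = t \<cdot> b \<cdot> c"
    using assoc[OF abc(3,1) t(1)] assoc[OF abc(3,2) t(1)] by simp
  then have "t \<cdot> a \<cdot> c = t"
    using c comp_Id[OF t(1)] by simp
  then have "a \<cdot> c \<in> Aut C t"
    using Aut_comp[OF g ab(1) c(1)] g t(1) by (auto simp: mem_Aut_iff)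
  then have "a \<cdot> c = Id C G"
    using Aut_t Id_in_Aut[OF t(1)] by (metis card_le_Suc0_iff_eq One_nat_def)
  then have "Id C G \<cdot> b = a"
    using assoc[OF abc(2,3,1)] c comp_Id[OF abc(1)] by simp
  then show ?thesis
    using comp_Id[OF abc(2)] by simp
qed

lemma deg_galois_closure_dvd:
  assumes "cover C S f" "galois_closure C S deg f g"
  shows "deg g dvd fact (deg f)"
proof -
  have galois: "galois_cover C S deg g" and "below C f g"
    using assms by (auto simp: galois_closure_def)
  obtain B A where f: "arr f B A" "B \<in> S" "A \<in> S" using assms(1) by (rule coverE)
  obtain G where g: "arr g G A" "G \<in> S"
    using galois \<open>below C f g\<close> f by (auto simp: galois_cover_def below_def cover_iff arr_def)
  note hom = card_Hom_le[OF f(1) g(1) f(3,2) g(2)]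
  have "card (Aut C g) dvd fact (card (Hom C g f))"
    using card_Aut_dvd_fact[OF g(1) f(1) hom(1)]
      galois_closure_faithful[OF f(1) g(1) f(3,2) g(2) assms(2)] by blast
  \<comment> \<open>The set \<open>Hom C g f\<close> is only known to have at most
    \<open>deg f\<close> elements; factorials turn this inequality into divisibility.\<close>
  also have "\<dots> dvd fact (deg f)"
    using hom(2) by (rule fact_dvd)
  finally show ?thesis
    using galois by (simp add: galois_cover_def)
qed

end

theorem theorem4p15:
  fixes C :: "('o, 'a) cat" and S :: "'o set" and \<Sigma> :: "'o \<Rightarrow> 'a set" and deg :: "'a \<Rightarrow> nat"
    and f g :: 'a
  assumes "covering_setting C S \<Sigma> deg"
    and G5: "\<And>U i. U \<in> Obj C \<Longrightarrow> i \<in> \<Sigma> U \<Longrightarrow> monic C i"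
    and "cover C S f"
    and "galois_closure C S deg f g"
  shows "deg g dvd fact (deg f)"
proof -
  interpret covering_setting C S \<Sigma> deg by fact
  interpret mono_covering_setting C S \<Sigma> deg
    by unfold_locales (rule G5)
  show ?thesis using assms(3,4) by (rule deg_galois_closure_dvd)
qed

end
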